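(* (Generic) fundamental circle complexes are parametrised by solutions $\tau$ of the dCKP equation $$(\tau\tau_{123}+\tau_1\tau_{23}-\tau_2\tau_{13}-\tau_3\tau_{12})^2-4(\tau_{12}\tau_{13}-\tau_1\tau_{123})(\tau_2\tau_3-\tau\tau_{23})=0$$ and their first and second generation Bäcklund transforms $\tau_4,\tau_5$ and $\tau_{45}$. That is, for any (generic) fundamental circle complex, let $\mathcal M=(M^{ik})_{i,k=1,\dots,5}$ be a real symmetric solution of the $M$-system by which it is represented, let $\tau:\mathbb Z^3\to\mathbb R\setminus\{0\}$ be a solution of the compatible linear system $\tau_i=M^{ii}\tau$, $i=1,2,3$, and define $$\tau_4=M^{44}\tau,\qquad \tau_5=M^{55}\tau,\qquad \tau_{45}=\bigl(M^{44}M^{55}-(M^{45})^2\bigr)\tau .$$ Then each of the four functions $\tau,\tau_4,\tau_5,\tau_{45}$ on $\mathbb Z^3$ satisfies the dCKP equation, and the circles are represented by the homogeneous coordinates $$(\gamma^{01},\gamma^{23},\gamma^{02},\gamma^{13},\gamma^{03})=\bigl(\tau,\;\tau_{45},\;\tau_4,\;\tau_5,\;\pm\sqrt{\tau_4\tau_5-\tau\tau_{45}}\,\bigr)$$ for a suitable choice of sign at each lattice site.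
   Context: Notation: for a function $f$ on $\mathbb Z^3$, lower indices $1,2,3$ denote unit shifts $n_l\mapsto n_l+1$ (e.g. $f_{23}=f(n_1,n_2+1,n_3+1)$); upper indices are labels. The indices $4,5$ on $\tau_4,\tau_5,\tau_{45}$ are labels defined by the formulas in the claim; shifts of these functions are again with respect to $n_1,n_2,n_3$. $M$-system: for $\mathcal M:\mathbb Z^3\to\mathbb R^{5\times5}$, $M^{ik}_l=M^{ik}-M^{il}M^{lk}/M^{ll}$ for $i,k\in\{1,\dots,5\}$ and $l\in\{1,2,3\}\setminus\{i,k\}$, with $M^{ll}\neq0$ for $l=1,2,3$. Line complexes: a map $\mathsf l:\mathbb Z^3\to\{\text{lines in }\mathbb{RP}^3\}$ is a fundamental line complex if any neighbouring lines $\mathsf l,\mathsf l_l$ intersect, in a point $\mathsf p^l$, and for distinct $l,m,p$ the points $\mathsf p^l,\mathsf p^l_m,\mathsf p^l_{mp},\mathsf p^l_p$ are coplanar. The line through points $\alpha,\beta$ has Plücker coordinates $\gamma^{\mu\nu}=\alpha^\mu\beta^\nu-\alpha^\nu\beta^\mu$. $\mathcal L$ denotes the linear line complex $\gamma^{03}=\gamma^{12}$; its lines are points $(\gamma^{01},\gamma^{23},\gamma^{02},\gamma^{13},\gamma^{03})$ of the quadric $2\gamma^{01}\gamma^{23}-2\gamma^{02}\gamma^{13}+2(\gamma^{03})^2=0$ of signature $(3,2)$, which is identified by a fixed linear isometry with the Lie quadric $x^2+y^2-ab-r^2=0$ in $\mathbb{RP}^4$ whose points $(x,y,a,b,r)$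 represent oriented circles of the plane: $(x,y,1,x^2+y^2-r^2,r)$ is the circle of centre $(x,y)$ and signed radius $r$ (a point if $r=0$), $(v,w,0,2d,1)$, $v^2+w^2=1$, an oriented line, $(0,0,0,1,0)$ the point at infinity. A circle complex $\mathsf c:\mathbb Z^3\to\{\text{oriented circles}\}$ is fundamental if the circles, interpreted as lines of $\mathcal L$, form a fundamental line complex. A circle complex is represented by a real symmetric solution $\mathcal M$ of the $M$-system if its lines have Plücker coordinates $(\gamma^{01},\gamma^{23},\gamma^{02},\gamma^{13},\gamma^{03},\gamma^{12})=(1,M^{44}M^{55}-(M^{45})^2,M^{44},M^{55},M^{45},M^{45})$. Generic fundamental circle complexes are those admitting such a representation (all fundamental circle complexes in general position do). *)

theory Defs
  imports "HOL-Analysis.Analysis"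
begin

type_synonym lattice = "int \<times> int \<times> int"

text \<open>
  The labels 1, ..., 5 are the elements of the numeral type \<open>5\<close> (in which \<open>5 = 0\<close>);
  the lattice directions are the labels 1, 2, 3.  Correspondingly, the coordinates
  0, ..., 3 of \<open>\<real>\<^sup>4\<close> are indexed by the numeral type \<open>4\<close>.
\<close>

definition shift :: "5 \<Rightarrow> lattice \<Rightarrow> lattice" where
  "shift l n = (case n of (n1, n2, n3) \<Rightarrow>
     (if l = 1 then (n1 + 1, n2, n3)
      else if l = 2 then (n1, n2 + 1, n3)
      else if l = 3 then (n1, n2, n3 + 1)
      else (n1, n2, n3)))"

definition M_system :: "(lattice \<Rightarrow> real^5^5) \<Rightarrow> bool" where
  "M_system M \<longleftrightarrow>
     (\<forall>n. \<forall>l\<in>{1, 2, 3}. M n $ l $ l \<noteq> 0) \<and>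
     (\<forall>n i k. \<forall>l\<in>{1, 2, 3} - {i, k}.
        M (shift l n) $ i $ k = M n $ i $ k - M n $ i $ l * M n $ l $ k / M n $ l $ l)"

definition tau_system :: "(lattice \<Rightarrow> real^5^5) \<Rightarrow> (lattice \<Rightarrow> real) \<Rightarrow> bool" where
  "tau_system M \<tau> \<longleftrightarrow> (\<forall>n. \<forall>i\<in>{1, 2, 3}. \<tau> (shift i n) = M n $ i $ i * \<tau> n)"

definition dCKP :: "(lattice \<Rightarrow> real) \<Rightarrow> bool" where
  "dCKP \<tau> \<longleftrightarrow> (\<forall>n.
     let t = \<tau> n;
         t1 = \<tau> (shift 1 n); t2 = \<tau> (shift 2 n); t3 = \<tau> (shift 3 n);
         t12 = \<tau> (shift 1 (shift 2 n)); t13 = \<tau> (shift 1 (shift 3 n));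
         t23 = \<tau> (shift 2 (shift 3 n)); t123 = \<tau> (shift 1 (shift 2 (shift 3 n)))
     in (t * t123 + t1 * t23 - t2 * t13 - t3 * t12)\<^sup>2
        - 4 * (t12 * t13 - t1 * t123) * (t2 * t3 - t * t23) = 0)"

text \<open>
  Points, lines and planes of \<open>\<real>P\<^sup>3\<close> are the linear subspaces of \<open>\<real>\<^sup>4\<close> of
  dimension 1, 2 and 3.
\<close>

definition proj_line :: "(real^4) set \<Rightarrow> bool" where
  "proj_line L \<longleftrightarrow> subspace L \<and> dim L = 2"

definition proj_coplanar :: "(real^4) set set \<Rightarrow> bool" where
  "proj_coplanar S \<longleftrightarrow> (\<exists>P. subspace P \<and> dim P = 3 \<and> (\<forall>p\<in>S. p \<subseteq> P))"

definition meet_point :: "(lattice \<Rightarrow> (real^4) set) \<Rightarrow> 5 \<Rightarrow> lattice \<Rightarrow> (real^4) set" where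
  "meet_point L l n = L n \<inter> L (shift l n)"

definition fundamental_line_complex :: "(lattice \<Rightarrow> (real^4) set) \<Rightarrow> bool" where
  "fundamental_line_complex L \<longleftrightarrow>
     (\<forall>n. proj_line (L n)) \<and>
     (\<forall>n. \<forall>l\<in>{1, 2, 3}. dim (meet_point L l n) = 1) \<and>
     (\<forall>n. \<forall>l\<in>{1, 2, 3}. \<forall>m\<in>{1, 2, 3}. \<forall>p\<in>{1, 2, 3}. l \<noteq> m \<and> l \<noteq> p \<and> m \<noteq> p \<longrightarrow>
        proj_coplanar {meet_point L l n, meet_point L l (shift m n),
                       meet_point L l (shift m (shift p n)), meet_point L l (shift p n)})"

definition pluecker :: "real^4 \<Rightarrow> real^4 \<Rightarrow> 4 \<Rightarrow> 4 \<Rightarrow> real" where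
  "pluecker \<alpha> \<beta> \<mu> \<nu> = \<alpha> $ \<mu> * \<beta> $ \<nu> - \<alpha> $ \<nu> * \<beta> $ \<mu>"

text \<open>
  Rescaling a spanning point rescales all Pluecker coordinates, so the following relation
  is invariant under multiplication of the coordinates by a nonzero factor.
\<close>

definition has_pluecker ::
  "(real^4) set \<Rightarrow> real \<times> real \<times> real \<times> real \<times> real \<times> real \<Rightarrow> bool" where
  "has_pluecker L g \<longleftrightarrow> proj_line L \<and>
     (\<exists>\<alpha> \<beta>. L = span {\<alpha>, \<beta>} \<and>
        g = (pluecker \<alpha> \<beta> 0 1, pluecker \<alpha> \<beta> 2 3, pluecker \<alpha> \<beta> 0 2,
             pluecker \<alpha> \<beta> 1 3, pluecker \<alpha> \<beta> 0 3, pluecker \<alpha> \<beta> 1 2))"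

type_synonym coords5 = "real \<times> real \<times> real \<times> real \<times> real"

text \<open>The quadric of lines with \<open>\<gamma>\<^sup>0\<^sup>3 = \<gamma>\<^sup>1\<^sup>2\<close>, and the Lie quadric.\<close>

definition complex_form :: "coords5 \<Rightarrow> real" where
  "complex_form g = (case g of (g01, g23, g02, g13, g03) \<Rightarrow>
     2 * g01 * g23 - 2 * g02 * g13 + 2 * g03\<^sup>2)"

definition lie_form :: "coords5 \<Rightarrow> real" where
  "lie_form u = (case u of (x, y, a, b, r) \<Rightarrow> x\<^sup>2 + y\<^sup>2 - a * b - r\<^sup>2)"

definition lie_identification :: "(coords5 \<Rightarrow> coords5) \<Rightarrow> bool" where
  "lie_identification \<Phi> \<longleftrightarrow>
     linear \<Phi> \<and> bij \<Phi> \<and> (\<forall>g. lie_form (\<Phi> g) = complex_form g)"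

text \<open>
  \<open>OCircle x y r\<close> has centre \<open>(x, y)\<close> and signed radius \<open>r\<close>;
  \<open>OLine v w d\<close> has unit normal \<open>(v, w)\<close>, a condition imposed by \<open>oriented_circles\<close>.
\<close>

datatype ocircle = OCircle real real real | OLine real real real | Infinity_Point

definition oriented_circles :: "ocircle set" where
  "oriented_circles =
     {OCircle x y r | x y r. True} \<union> {OLine v w d | v w d. v\<^sup>2 + w\<^sup>2 = 1} \<union> {Infinity_Point}"

fun lie_coords :: "ocircle \<Rightarrow> coords5" where
  "lie_coords (OCircle x y r) = (x, y, 1, x\<^sup>2 + y\<^sup>2 - r\<^sup>2, r)"
| "lie_coords (OLine v w d) = (v, w, 0, 2 * d, 1)"
| "lie_coords Infinity_Point = (0, 0, 0, 1, 0)"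

definition circle_has_coords :: "(coords5 \<Rightarrow> coords5) \<Rightarrow> ocircle \<Rightarrow> coords5 \<Rightarrow> bool" where
  "circle_has_coords \<Phi> C g \<longleftrightarrow> (\<exists>k. k \<noteq> 0 \<and> \<Phi> g = k *\<^sub>R lie_coords C)"

text \<open>The line of the linear complex \<open>\<gamma>\<^sup>0\<^sup>3 = \<gamma>\<^sup>1\<^sup>2\<close> corresponding to a circle.\<close>

definition is_line_of_circle :: "(coords5 \<Rightarrow> coords5) \<Rightarrow> ocircle \<Rightarrow> (real^4) set \<Rightarrow> bool" where
  "is_line_of_circle \<Phi> C L \<longleftrightarrow> (\<exists>g01 g23 g02 g13 g03.
     has_pluecker L (g01, g23, g02, g13, g03, g03) \<and>
     circle_has_coords \<Phi> C (g01, g23, g02, g13, g03))"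

definition fundamental_circle_complex ::
  "(coords5 \<Rightarrow> coords5) \<Rightarrow> (lattice \<Rightarrow> ocircle) \<Rightarrow> bool" where
  "fundamental_circle_complex \<Phi> c \<longleftrightarrow>
     (\<forall>n. c n \<in> oriented_circles) \<and>
     (\<exists>L. (\<forall>n. is_line_of_circle \<Phi> (c n) (L n)) \<and> fundamental_line_complex L)"

definition represented_by ::
  "(coords5 \<Rightarrow> coords5) \<Rightarrow> (lattice \<Rightarrow> ocircle) \<Rightarrow> (lattice \<Rightarrow> real^5^5) \<Rightarrow> bool" where
  "represented_by \<Phi> c M \<longleftrightarrow>
     M_system M \<and> (\<forall>n. transpose (M n) = M n) \<and>
     (\<forall>n. \<exists>L. is_line_of_circle \<Phi> (c n) L \<and>
        has_pluecker L
          (1, M n $ 4 $ 4 * M n $ 5 $ 5 - (M n $ 4 $ 5)\<^sup>2, M n $ 4 $ 4, M n $ 5 $ 5,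
           M n $ 4 $ 5, M n $ 4 $ 5))"

end

theory Submission
  imports Defs
begin

text \<open>
  Each step of the \<open>M\<close>-system is a Schur complement, so the values of
  \<open>\<tau>\<^sub>4\<^sub>5\<close> on a unit cube are, up to the factor \<open>\<tau>\<close>, the principal minors of
  one symmetric matrix whose index sets contain 4 and 5.  By Jacobi's identity the form
  \<open>Q = f\<^sub>2 f\<^sub>3 - f f\<^sub>2\<^sub>3\<close> is the square of a mixed minor on a face of the
  cube.  The opposite face comes from a rank one update of the matrix, under which minors are
  affine in the parameter.  Hence \<open>Q\<close> is the square of an affine function along the segment
  joining the two faces, and dCKP is the vanishing of its discriminant.  The functions
  \<open>\<tau>, \<tau>\<^sub>4, \<tau>\<^sub>5\<close> are instances of \<open>\<tau>\<^sub>4\<^sub>5\<close> for matrices in which the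
  rows and columns 4 or 5 are replaced by those of the identity.
\<close>

section \<open>Multiplicative integration on the integer lattice\<close>

text \<open>For nowhere vanishing \<open>f\<close> this is the solution of
  \<open>F (n + 1) = f n * F n\<close> with \<open>F 0 = 1\<close> on all integers.\<close>

definition int_prod :: "(int \<Rightarrow> real) \<Rightarrow> int \<Rightarrow> real" where
  "int_prod f n = (if 0 \<le> n then \<Prod>k\<in>{0..<n}. f k else inverse (\<Prod>k\<in>{n..<0}. f k))"

lemma int_prod_0 [simp]: "int_prod f 0 = 1"
  by (simp add: int_prod_def)

lemma int_prod_nonzero:
  assumes "\<And>k. f k \<noteq> 0"
  shows "int_prod f n \<noteq> 0"
  using assms by (simp add: int_prod_def)

lemma int_prod_add_1:
  assumes "\<And>k. f k \<noteq> 0"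
  shows "int_prod f (n + 1) = f n * int_prod f n"
proof (cases "0 \<le> n")
  case True
  then have "{0..<n + 1} = insert n {0..<n}" by auto
  with True show ?thesis by (simp add: int_prod_def)
next
  case False
  then have "{n..<0} = insert n {n + 1..<0}" by auto
  then have "(\<Prod>k\<in>{n..<0}. f k) = f n * (\<Prod>k\<in>{n + 1..<0}. f k)" by simp
  \<comment> \<open>At \<open>n = -1\<close> the successor already belongs to the nonnegative
    branch.\<close>
  with False assms show ?thesis
    by (cases "n = -1") (auto simp: int_prod_def field_simps)
qed

text \<open>The factors \<open>g\<close> telescope: both sides are multiplied by \<open>f' n\<close>
  when \<open>n\<close> increases by one, and they agree at 0. This carries a product along one row
  over to the neighbouring row.\<close>

lemma int_prod_gauge:
  assumes f: "\<And>k. f k \<noteq> 0" and f': "\<And>k. f' k \<noteq> 0"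
    and gauge: "\<And>k. f' k * g k = g (k + 1) * f k"
  shows "int_prod f' n * g 0 = g n * int_prod f n"
proof (induction n rule: int_induct[where k = 0])
  case base
  show ?case by simp
next
  case (step1 i)
  have "int_prod f' (i + 1) * g 0 = f' i * (g i * int_prod f i)"
    using step1 by (simp add: int_prod_add_1[of f', OF f'])
  also have "\<dots> = (f' i * g i) * int_prod f i" by simp
  also have "\<dots> = g (i + 1) * int_prod f (i + 1)"
    by (simp add: gauge int_prod_add_1[of f, OF f])
  finally show ?case .
next
  case (step2 i)
  have "f' (i - 1) * (int_prod f' (i - 1) * g 0) = g i * int_prod f i"
    using int_prod_add_1[of f' "i - 1"] f' step2 by simp
  also have "\<dots> = (f' (i - 1) * g (i - 1)) * int_prod f (i - 1)"
    using int_prod_add_1[of f "i - 1"] f gauge[of "i - 1"] by simp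
  finally show ?case using f'[of "i - 1"] by simp
qed

lemma shift_simps [simp]:
  "shift 1 (a, b, c) = (a + 1, b, c)"
  "shift 2 (a, b, c) = (a, b + 1, c)"
  "shift 3 (a, b, c) = (a, b, c + 1)"
  by (simp_all add: shift_def)

lemma shift_commute: "shift l (shift m n) = shift m (shift l n)"
  by (cases n) (simp add: shift_def)

text \<open>A discrete Poincare lemma: \<open>\<tau>\<close> is the product of \<open>r\<close>
  along the path from the origin in direction 3, then 2, then 1.\<close>

lemma closed_multiplicative_form_exact:
  fixes r :: "5 \<Rightarrow> lattice \<Rightarrow> real"
  assumes nz: "\<And>l n. l \<in> {1, 2, 3} \<Longrightarrow> r l n \<noteq> 0"
    and closed: "\<And>l m n. \<lbrakk>l \<in> {1, 2, 3}; m \<in> {1, 2, 3}; l \<noteq> m\<rbrakk> \<Longrightarrow>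
      r l (shift m n) * r m n = r m (shift l n) * r l n"
  obtains \<tau> where "\<And>n. \<tau> n \<noteq> 0"
    and "\<And>l n. l \<in> {1, 2, 3} \<Longrightarrow> \<tau> (shift l n) = r l n * \<tau> n"
proof -
  define \<tau> where "\<tau> = (\<lambda>(n1, n2, n3).
    int_prod (\<lambda>k. r 1 (k, n2, n3)) n1 * int_prod (\<lambda>k. r 2 (0, k, n3)) n2 *
    int_prod (\<lambda>k. r 3 (0, 0, k)) n3)"
  have "\<tau> n \<noteq> 0" for n
    by (cases n) (simp add: \<tau>_def int_prod_nonzero nz)
  moreover have "\<tau> (shift l n) = r l n * \<tau> n" if l: "l \<in> {1, 2, 3}" for l n
  proof -
    obtain n1 n2 n3 where n: "n = (n1, n2, n3)" by (cases n)
    \<comment> \<open>A shift in direction 2 or 3 displaces the later legs of the path; closedness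
      on the squares swept out is the gauge relation.\<close>
    have g12: "int_prod (\<lambda>k. r 1 (k, n2 + 1, n3)) n1 * r 2 (0, n2, n3)
        = r 2 (n1, n2, n3) * int_prod (\<lambda>k. r 1 (k, n2, n3)) n1"
      by (rule int_prod_gauge) (use nz closed[of 1 2 "(_, n2, n3)"] in auto)
    have g13: "int_prod (\<lambda>k. r 1 (k, n2, n3 + 1)) n1 * r 3 (0, n2, n3)
        = r 3 (n1, n2, n3) * int_prod (\<lambda>k. r 1 (k, n2, n3)) n1"
      by (rule int_prod_gauge) (use nz closed[of 1 3 "(_, n2, n3)"] in auto)
    have g23: "int_prod (\<lambda>k. r 2 (0, k, n3 + 1)) n2 * r 3 (0, 0, n3)
        = r 3 (0, n2, n3) * int_prod (\<lambda>k. r 2 (0, k, n3)) n2"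
      by (rule int_prod_gauge) (use nz closed[of 2 3 "(0, _, n3)"] in auto)
    consider "l = 1" | "l = 2" | "l = 3" using l by auto
    then show ?thesis
    proof cases
      case 1
      then show ?thesis by (simp add: n \<tau>_def int_prod_add_1 nz)
    next
      case 2
      then show ?thesis using g12 by (simp add: n \<tau>_def int_prod_add_1 nz)
    next
      case 3
      then show ?thesis using g13 g23 by (simp add: n \<tau>_def int_prod_add_1 nz)
    qed
  qed
  ultimately show ?thesis by (rule that)
qed

section \<open>The linear system for \<open>\<tau>\<close>\<close>

lemma M_system_nonzero: "\<lbrakk>M_system M; l \<in> {1, 2, 3}\<rbrakk> \<Longrightarrow> M n $ l $ l \<noteq> 0"
  unfolding M_system_def by blast

lemma M_system_step:
  assumes "M_system M" "l \<in> {1, 2, 3}" "l \<noteq> i" "l \<noteq> k"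
  shows "M (shift l n) $ i $ k = M n $ i $ k - M n $ i $ l * M n $ l $ k / M n $ l $ l"
  using assms unfolding M_system_def by blast

lemma tau_system_solvable:
  assumes "M_system M"
  shows "\<exists>\<tau>. (\<forall>n. \<tau> n \<noteq> 0) \<and> tau_system M \<tau>"
proof -
  note nz = M_system_nonzero[OF assms] and step = M_system_step[OF assms]
  \<comment> \<open>Both sides equal the 2x2 minor on the labels \<open>l, m\<close>, which is
    symmetric in the two directions.\<close>
  have "M (shift m n) $ l $ l * M n $ m $ m = M (shift l n) $ m $ m * M n $ l $ l"
    if "l \<in> {1, 2, 3}" "m \<in> {1, 2, 3}" "l \<noteq> m" for l m n
    using that by (simp add: step nz field_simps)
  then obtain \<tau> where "\<And>n. \<tau> n \<noteq> 0"
    and "\<And>l n. l \<in> {1, 2, 3} \<Longrightarrow> \<tau> (shift l n) = M n $ l $ l * \<tau> n"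
    using closed_multiplicative_form_exact[of "\<lambda>l n. M n $ l $ l"] nz by metis
  then show ?thesis unfolding tau_system_def by blast
qed

section \<open>Minors of symmetric matrices and the hyperdeterminant\<close>

text \<open>
  Principal minors, and in \<open>mdet3 X i j k l\<close> the minor with rows \<open>i, k, l\<close> and columns
  \<open>j, k, l\<close>, of a symmetric matrix; the entry for a pair of indices is read off in
  argument order.
\<close>

definition sdet2 :: "real^5^5 \<Rightarrow> 5 \<Rightarrow> 5 \<Rightarrow> real" where
  "sdet2 X i j = X $ i $ i * X $ j $ j - (X $ i $ j)\<^sup>2"

definition sdet3 :: "real^5^5 \<Rightarrow> 5 \<Rightarrow> 5 \<Rightarrow> 5 \<Rightarrow> real" where
  "sdet3 X i j k = X $ i $ i * sdet2 X j k - X $ j $ j * (X $ i $ k)\<^sup>2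
     - X $ k $ k * (X $ i $ j)\<^sup>2 + 2 * X $ i $ j * X $ i $ k * X $ j $ k"

definition mdet3 :: "real^5^5 \<Rightarrow> 5 \<Rightarrow> 5 \<Rightarrow> 5 \<Rightarrow> 5 \<Rightarrow> real" where
  "mdet3 X i j k l = X $ i $ j * sdet2 X k l
     - X $ i $ k * (X $ j $ k * X $ l $ l - X $ k $ l * X $ j $ l)
     + X $ i $ l * (X $ j $ k * X $ k $ l - X $ k $ k * X $ j $ l)"

definition sdet4 :: "real^5^5 \<Rightarrow> 5 \<Rightarrow> 5 \<Rightarrow> 5 \<Rightarrow> 5 \<Rightarrow> real" where
  "sdet4 X i j k l = X $ i $ i * sdet3 X j k l
     - (X $ i $ j)\<^sup>2 * sdet2 X k l - (X $ i $ k)\<^sup>2 * sdet2 X j l - (X $ i $ l)\<^sup>2 * sdet2 X j k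
     + 2 * X $ i $ j * X $ i $ k * (X $ j $ k * X $ l $ l - X $ j $ l * X $ k $ l)
     + 2 * X $ i $ j * X $ i $ l * (X $ j $ l * X $ k $ k - X $ j $ k * X $ k $ l)
     + 2 * X $ i $ k * X $ i $ l * (X $ j $ j * X $ k $ l - X $ j $ k * X $ j $ l)"

lemmas sdet_defs = sdet2_def sdet3_def sdet4_def mdet3_def

text \<open>Condensation of the 4x4 minor: by symmetry its two mixed minors coincide, hence the
  square. Each entry is read in one order only, so this is a polynomial identity in the ten entries
  on and above the diagonal.\<close>

lemma sdet_jacobi:
  "sdet3 X i k l * sdet3 X j k l - sdet2 X k l * sdet4 X i j k l = (mdet3 X i j k l)\<^sup>2"
  unfolding sdet_defs by algebra

text \<open>If \<open>b\<close> is a pivot row of a symmetric matrix and \<open>s\<close> the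
  inverse pivot, this is the Schur complement, padded by zeros in the row and column of the
  pivot.\<close>

definition rank_one_update :: "real^5^5 \<Rightarrow> real^5 \<Rightarrow> real \<Rightarrow> real^5^5" where
  "rank_one_update X b s = (\<chi> i j. X $ i $ j - s * b $ i * b $ j)"

text \<open>Higher powers of \<open>s\<close> come with minors of size at least two of a rank one
  matrix, which vanish; the midpoint rule expresses that each minor is affine in
  \<open>s\<close>.\<close>

lemma sdet_rank_one_midpoint:
  fixes X :: "real^5^5" and b :: "real^5" and s :: real
  defines "Y \<equiv> rank_one_update X b (s + s)" and "Z \<equiv> rank_one_update X b s"
  shows "2 * sdet2 Z i j = sdet2 X i j + sdet2 Y i j"
    and "2 * sdet3 Z i j k = sdet3 X i j k + sdet3 Y i j k"
    and "2 * sdet4 Z i j k l = sdet4 X i j k l + sdet4 Y i j k l"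
    and "2 * mdet3 Z i j k l = mdet3 X i j k l + mdet3 Y i j k l"
  unfolding Y_def Z_def sdet_defs rank_one_update_def
  by (simp_all add: algebra_simps power2_eq_square)

text \<open>Cayley's 2x2x2 hyperdeterminant of the minors of \<open>X\<close> and \<open>Y\<close>.
  The expression being squared is, up to sign, twice the product of the mixed minors of
  \<open>X\<close> and \<open>Y\<close>, while the other two factors are the squares of these
  minors.\<close>

lemma sdet_hyperdeterminant:
  fixes X :: "real^5^5" and b :: "real^5" and s :: real
  defines "Y \<equiv> rank_one_update X b s"
  shows "(sdet2 X k l * sdet4 Y i j k l + sdet2 Y k l * sdet4 X i j k l
      - sdet3 X i k l * sdet3 Y j k l - sdet3 X j k l * sdet3 Y i k l)\<^sup>2
    - 4 * (sdet3 Y i k l * sdet3 Y j k l - sdet2 Y k l * sdet4 Y i j k l)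
      * (sdet3 X i k l * sdet3 X j k l - sdet2 X k l * sdet4 X i j k l) = 0"
proof -
  \<comment> \<open>Jacobi's identity at the midpoint \<open>Z\<close> polarises the one at the endpoints \<open>X\<close> and \<open>Y\<close>.\<close>
  define Z where "Z = rank_one_update X b (s / 2)"
  note mid = sdet_rank_one_midpoint[of X b "s / 2", simplified, folded Y_def Z_def]
  have "(2 * sdet3 Z i k l) * (2 * sdet3 Z j k l) - (2 * sdet2 Z k l) * (2 * sdet4 Z i j k l)
      = (2 * mdet3 Z i j k l)\<^sup>2"
    using sdet_jacobi[of Z i k l j] by algebra
  then show ?thesis
    using sdet_jacobi[of X i k l j] sdet_jacobi[of Y i k l j] unfolding mid by algebra
qed

text \<open>Schur's formula: a determinant is the pivot times the determinant of the Schur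
  complement.\<close>

lemma pivot_sdet:
  fixes X Y :: "real^5^5"
  assumes nz: "X $ l $ l \<noteq> 0"
    and sym: "\<And>p q. X $ p $ q = X $ q $ p"
    and schur: "\<And>p q. \<lbrakk>l \<noteq> p; l \<noteq> q\<rbrakk> \<Longrightarrow>
      Y $ p $ q = X $ p $ q - X $ p $ l * X $ l $ q / X $ l $ l"
    and "l \<noteq> i" "l \<noteq> j" "l \<noteq> k"
  shows "sdet2 Y i j * X $ l $ l = sdet3 X l i j"
    and "sdet3 Y i j k * X $ l $ l = sdet4 X l i j k"
proof -
  have Y: "Y $ p $ q = X $ p $ q - inverse (X $ l $ l) * X $ l $ p * X $ l $ q"
    if "p \<in> {i, j, k}" "q \<in> {i, j, k}" for p q
    using that assms(4-) schur[of p q] sym[of p l] by (auto simp: field_simps)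
  have inv: "inverse (X $ l $ l) * X $ l $ l = 1" using nz by simp
  \<comment> \<open>This is polynomial with the inverse pivot as a free variable, in which the minor
    is affine; \<open>inv\<close> enters only afterwards.\<close>
  have "sdet2 Y i j = sdet2 X i j
      - inverse (X $ l $ l) * (X $ l $ l * sdet2 X i j - sdet3 X l i j)"
    unfolding sdet_defs by (simp add: Y) algebra
  with inv show "sdet2 Y i j * X $ l $ l = sdet3 X l i j" by algebra
  have "sdet3 Y i j k = sdet3 X i j k
      - inverse (X $ l $ l) * (X $ l $ l * sdet3 X i j k - sdet4 X l i j k)"
    unfolding sdet_defs by (simp add: Y) algebra
  with inv show "sdet3 Y i j k * X $ l $ l = sdet4 X l i j k" by algebra
qed

section \<open>The dCKP equation for principal minors\<close>

text \<open>The factor \<open>\<tau>\<close> absorbs the pivots, so each shift borders the minor by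
  the label of its direction.\<close>

lemma dCKP_sdet2:
  assumes M: "M_system M" and sym: "\<And>n. transpose (M n) = M n"
    and \<tau>: "tau_system M \<tau>"
  shows "dCKP (\<lambda>n. sdet2 (M n) 4 5 * \<tau> n)"
proof -
  note nz = M_system_nonzero[OF M] and step = M_system_step[OF M]
  have sym': "M n $ p $ q = M n $ q $ p" for n p q
    using arg_cong[OF sym[of n], of "\<lambda>X. X $ p $ q"] by (simp add: transpose_def)
  have \<tau>_shift: "\<tau> (shift l n) = M n $ l $ l * \<tau> n" if "l \<in> {1, 2, 3}" for l n
    using \<tau> that unfolding tau_system_def by blast
  define f where "f = (\<lambda>n. sdet2 (M n) 4 5 * \<tau> n)"
  have f1: "f (shift l n) = sdet3 (M n) l 4 5 * \<tau> n" if "l \<in> {1, 2, 3}" for l n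
  proof -
    \<comment> \<open>Here \<open>k = 4\<close> is a placeholder for a third label off the
      pivot.\<close>
    have "sdet2 (M (shift l n)) 4 5 * M n $ l $ l = sdet3 (M n) l 4 5"
      using that by (intro pivot_sdet(1)[where k = 4] nz sym' step) auto
    with that show ?thesis by (simp add: f_def \<tau>_shift flip: mult.assoc)
  qed
  have f2: "f (shift 2 (shift 3 n)) = sdet4 (M n) 2 3 4 5 * \<tau> n" for n
  proof -
    have "sdet3 (M (shift 2 n)) 3 4 5 * M n $ 2 $ 2 = sdet4 (M n) 2 3 4 5"
      by (intro pivot_sdet(2) nz sym' step) auto
    then show ?thesis
      by (simp add: shift_commute[of 2 3] f1 \<tau>_shift flip: mult.assoc)
  qed
  show ?thesis
    unfolding dCKP_def Let_def f_def[symmetric]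
  proof
    fix n
    \<comment> \<open>Shifting in direction 1 eliminates the pivot 1: \<open>N\<close> agrees with
      \<open>Y\<close> off the label 1, and the minors on the shifted face involve only the other
      labels.\<close>
    define Y where "Y = rank_one_update (M n) (M n $ 1) (inverse (M n $ 1 $ 1))"
    define N where "N = M (shift 1 n)"
    have N: "N $ p $ q = Y $ p $ q" if "p \<noteq> 1" "q \<noteq> 1" for p q
      using that step[of 1 p q n] sym'[of n p 1]
      by (simp add: N_def Y_def rank_one_update_def field_simps)
    have eqs: "sdet2 N 4 5 = sdet2 Y 4 5" "sdet3 N 2 4 5 = sdet3 Y 2 4 5"
      "sdet3 N 3 4 5 = sdet3 Y 3 4 5" "sdet4 N 2 3 4 5 = sdet4 Y 2 3 4 5"
      unfolding sdet_defs by (simp_all add: N)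
    have f_shift_1: "f (shift 1 n) = sdet2 Y 4 5 * (M n $ 1 $ 1 * \<tau> n)"
      using eqs by (simp add: f_def \<tau>_shift flip: N_def)
    \<comment> \<open>The shift in direction 1 is moved innermost, so that \<open>f1\<close> and
      \<open>f2\<close> apply at the base point \<open>shift 1 n\<close>.\<close>
    have vals: "f n = sdet2 (M n) 4 5 * \<tau> n"
      "f (shift 2 n) = sdet3 (M n) 2 4 5 * \<tau> n"
      "f (shift 3 n) = sdet3 (M n) 3 4 5 * \<tau> n"
      "f (shift 1 (shift 2 n)) = sdet3 Y 2 4 5 * (M n $ 1 $ 1 * \<tau> n)"
      "f (shift 1 (shift 3 n)) = sdet3 Y 3 4 5 * (M n $ 1 $ 1 * \<tau> n)"
      "f (shift 2 (shift 3 n)) = sdet4 (M n) 2 3 4 5 * \<tau> n"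
      "f (shift 1 (shift 2 (shift 3 n))) = sdet4 Y 2 3 4 5 * (M n $ 1 $ 1 * \<tau> n)"
      unfolding shift_commute[of 1 2] shift_commute[of 1 3] f2 using eqs
      by (simp_all add: f1 \<tau>_shift flip: N_def) (simp add: f_def)
    \<comment> \<open>The expression is quadratic in the values on each of the two faces, so the
      common factors \<open>\<tau> n\<close> and \<open>M n $ 1 $ 1 * \<tau> n\<close> split
      off.\<close>
    show "(f n * f (shift 1 (shift 2 (shift 3 n))) + f (shift 1 n) * f (shift 2 (shift 3 n))
        - f (shift 2 n) * f (shift 1 (shift 3 n)) - f (shift 3 n) * f (shift 1 (shift 2 n)))\<^sup>2
      - 4 * (f (shift 1 (shift 2 n)) * f (shift 1 (shift 3 n))
          - f (shift 1 n) * f (shift 1 (shift 2 (shift 3 n))))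
        * (f (shift 2 n) * f (shift 3 n) - f n * f (shift 2 (shift 3 n))) = 0"
      unfolding f_shift_1 vals
      using sdet_hyperdeterminant[of "M n" 4 5 "M n $ 1" "inverse (M n $ 1 $ 1)" 2 3]
      unfolding Y_def[symmetric] by algebra
  qed
qed

text \<open>A principal minor containing \<open>j\<close> turns into the one with \<open>j\<close>
  deleted, so the pair 4, 5 covers all four functions.\<close>

definition decouple :: "5 \<Rightarrow> real^5^5 \<Rightarrow> real^5^5" where
  "decouple j X = (\<chi> i k. if i = j \<or> k = j then of_bool (i = k) else X $ i $ k)"

text \<open>As \<open>j\<close> is no lattice direction, its entries against every direction vanish;
  the corrections to row and column \<open>j\<close> are then zero.\<close>

lemma M_system_decouple:
  assumes "M_system M" "j \<notin> {1, 2, 3}"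
  shows "M_system (\<lambda>n. decouple j (M n))"
  using assms unfolding M_system_def decouple_def by auto

lemma tau_system_decouple:
  assumes "tau_system M \<tau>" "j \<notin> {1, 2, 3}"
  shows "tau_system (\<lambda>n. decouple j (M n)) \<tau>"
  using assms unfolding tau_system_def decouple_def by auto

lemma transpose_decouple:
  assumes "transpose X = X"
  shows "transpose (decouple j X) = decouple j X"
  using assms by (auto simp: decouple_def transpose_def vec_eq_iff)

lemma dCKP_principal_minors:
  assumes M: "M_system M" and sym: "\<And>n. transpose (M n) = M n"
    and \<tau>: "tau_system M \<tau>"
  shows "dCKP \<tau>"
    and "dCKP (\<lambda>n. M n $ 4 $ 4 * \<tau> n)"
    and "dCKP (\<lambda>n. M n $ 5 $ 5 * \<tau> n)"
    and "dCKP (\<lambda>n. (M n $ 4 $ 4 * M n $ 5 $ 5 - (M n $ 4 $ 5)\<^sup>2) * \<tau> n)"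
proof -
  have j: "4 \<notin> {1, 2, 3 :: 5}" "5 \<notin> {1, 2, 3 :: 5}" by auto
  note dec = M_system_decouple tau_system_decouple transpose_decouple
  show "dCKP (\<lambda>n. (M n $ 4 $ 4 * M n $ 5 $ 5 - (M n $ 4 $ 5)\<^sup>2) * \<tau> n)"
    using dCKP_sdet2[OF assms] by (simp add: sdet2_def)
  have "dCKP (\<lambda>n. sdet2 (decouple 5 (M n)) 4 5 * \<tau> n)"
    by (intro dCKP_sdet2 dec assms j)
  then show "dCKP (\<lambda>n. M n $ 4 $ 4 * \<tau> n)"
    by (simp add: sdet2_def decouple_def)
  have "dCKP (\<lambda>n. sdet2 (decouple 4 (M n)) 4 5 * \<tau> n)"
    by (intro dCKP_sdet2 dec assms j)
  then show "dCKP (\<lambda>n. M n $ 5 $ 5 * \<tau> n)"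
    by (simp add: sdet2_def decouple_def)
  have "dCKP (\<lambda>n. sdet2 (decouple 4 (decouple 5 (M n))) 4 5 * \<tau> n)"
    by (intro dCKP_sdet2 dec assms j)
  then show "dCKP \<tau>"
    by (simp add: sdet2_def decouple_def)
qed

section \<open>Pluecker coordinates of lines and circles\<close>

lemma pluecker_change_basis:
  "pluecker (a *\<^sub>R \<alpha> + b *\<^sub>R \<beta>) (c *\<^sub>R \<alpha> + d *\<^sub>R \<beta>) \<mu> \<nu> = (a * d - b * c) * pluecker \<alpha> \<beta> \<mu> \<nu>"
  by (simp add: pluecker_def algebra_simps)

text \<open>The factor is the determinant of the matrix expressing one spanning pair in the
  other.\<close>

lemma has_pluecker_proportional:
  assumes "has_pluecker L g" "has_pluecker L h"
  obtains k where "h = k *\<^sub>R g"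
proof -
  obtain \<alpha> \<beta> where L: "L = span {\<alpha>, \<beta>}"
    and g: "g = (pluecker \<alpha> \<beta> 0 1, pluecker \<alpha> \<beta> 2 3, pluecker \<alpha> \<beta> 0 2,
             pluecker \<alpha> \<beta> 1 3, pluecker \<alpha> \<beta> 0 3, pluecker \<alpha> \<beta> 1 2)"
    using assms(1) unfolding has_pluecker_def by blast
  obtain \<alpha>' \<beta>' where L': "L = span {\<alpha>', \<beta>'}"
    and h: "h = (pluecker \<alpha>' \<beta>' 0 1, pluecker \<alpha>' \<beta>' 2 3, pluecker \<alpha>' \<beta>' 0 2,
             pluecker \<alpha>' \<beta>' 1 3, pluecker \<alpha>' \<beta>' 0 3, pluecker \<alpha>' \<beta>' 1 2)"
    using assms(2) unfolding has_pluecker_def by blast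
  have comb: "\<exists>a b. v = a *\<^sub>R \<alpha> + b *\<^sub>R \<beta>" if "v \<in> L" for v
    using that unfolding L span_insert span_empty
    by (auto simp: algebra_simps)
  obtain a b where a: "\<alpha>' = a *\<^sub>R \<alpha> + b *\<^sub>R \<beta>"
    using comb L' by (meson insertCI span_base)
  obtain c d where c: "\<beta>' = c *\<^sub>R \<alpha> + d *\<^sub>R \<beta>"
    using comb L' by (meson insertCI span_base)
  have "h = (a * d - b * c) *\<^sub>R g"
    unfolding g h a c pluecker_change_basis by simp
  then show ?thesis by (rule that)
qed

lemma circle_has_coords_scaleR:
  assumes "linear \<Phi>" "circle_has_coords \<Phi> C g" "k \<noteq> 0"
  shows "circle_has_coords \<Phi> C (k *\<^sub>R g)"
proof -
  obtain q where "q \<noteq> 0" "\<Phi> g = q *\<^sub>R lie_coords C"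
    using assms(2) unfolding circle_has_coords_def by blast
  then show ?thesis
    unfolding circle_has_coords_def using assms(1,3)
    by (intro exI[of _ "k * q"]) (simp add: linear_cmul)
qed

text \<open>The circle and the matrix each give coordinates of the same line, and these are
  proportional.\<close>

lemma represented_by_coords:
  assumes "linear \<Phi>" "represented_by \<Phi> c M"
  shows "circle_has_coords \<Phi> (c n)
    (1, M n $ 4 $ 4 * M n $ 5 $ 5 - (M n $ 4 $ 5)\<^sup>2, M n $ 4 $ 4, M n $ 5 $ 5, M n $ 4 $ 5)"
    (is "circle_has_coords _ _ ?h")
proof -
  obtain L where "is_line_of_circle \<Phi> (c n) L"
    and h: "has_pluecker L
          (1, M n $ 4 $ 4 * M n $ 5 $ 5 - (M n $ 4 $ 5)\<^sup>2, M n $ 4 $ 4, M n $ 5 $ 5,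
           M n $ 4 $ 5, M n $ 4 $ 5)"
    using assms(2) unfolding represented_by_def by blast
  then obtain g01 g23 g02 g13 g03 where g: "has_pluecker L (g01, g23, g02, g13, g03, g03)"
    and circ: "circle_has_coords \<Phi> (c n) (g01, g23, g02, g13, g03)"
    unfolding is_line_of_circle_def by blast
  obtain k where k: "(1, M n $ 4 $ 4 * M n $ 5 $ 5 - (M n $ 4 $ 5)\<^sup>2, M n $ 4 $ 4, M n $ 5 $ 5,
           M n $ 4 $ 5, M n $ 4 $ 5) = k *\<^sub>R (g01, g23, g02, g13, g03, g03)"
    using has_pluecker_proportional[OF g h] .
  \<comment> \<open>The first coordinate 1 excludes \<open>k = 0\<close>.\<close>
  then have "k \<noteq> 0" and "?h = k *\<^sub>R (g01, g23, g02, g13, g03)" by auto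
  with circle_has_coords_scaleR[OF assms(1) circ] show ?thesis by metis
qed

theorem theorem4p3:
  fixes \<Phi> :: "coords5 \<Rightarrow> coords5"
    and c :: "lattice \<Rightarrow> ocircle"
    and M :: "lattice \<Rightarrow> real^5^5"
  assumes "lie_identification \<Phi>"
    and "fundamental_circle_complex \<Phi> c"
    and "represented_by \<Phi> c M"
  shows "(\<exists>\<tau>. (\<forall>n. \<tau> n \<noteq> 0) \<and> tau_system M \<tau>) \<and>
    (\<forall>\<tau> \<tau>4 \<tau>5 \<tau>45.
       (\<forall>n. \<tau> n \<noteq> 0) \<and> tau_system M \<tau> \<and>
       (\<forall>n. \<tau>4 n = M n $ 4 $ 4 * \<tau> n) \<and>
       (\<forall>n. \<tau>5 n = M n $ 5 $ 5 * \<tau> n) \<and>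
       (\<forall>n. \<tau>45 n = (M n $ 4 $ 4 * M n $ 5 $ 5 - (M n $ 4 $ 5)\<^sup>2) * \<tau> n) \<longrightarrow>
       dCKP \<tau> \<and> dCKP \<tau>4 \<and> dCKP \<tau>5 \<and> dCKP \<tau>45 \<and>
       (\<exists>\<sigma> :: lattice \<Rightarrow> real. (\<forall>n. \<sigma> n = 1 \<or> \<sigma> n = -1) \<and>
          (\<forall>n. circle_has_coords \<Phi> (c n)
             (\<tau> n, \<tau>45 n, \<tau>4 n, \<tau>5 n, \<sigma> n * sqrt (\<tau>4 n * \<tau>5 n - \<tau> n * \<tau>45 n)))))"
proof (intro conjI allI impI; (elim conjE)?)
  have M: "M_system M" and sym: "\<And>n. transpose (M n) = M n"
    using assms(3) unfolding represented_by_def by blast+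
  show "\<exists>\<tau>. (\<forall>n. \<tau> n \<noteq> 0) \<and> tau_system M \<tau>"
    by (rule tau_system_solvable[OF M])
  fix \<tau> \<tau>4 \<tau>5 \<tau>45 :: "lattice \<Rightarrow> real"
  assume nz: "\<forall>n. \<tau> n \<noteq> 0" and \<tau>: "tau_system M \<tau>"
    and "\<forall>n. \<tau>4 n = M n $ 4 $ 4 * \<tau> n" "\<forall>n. \<tau>5 n = M n $ 5 $ 5 * \<tau> n"
      "\<forall>n. \<tau>45 n = (M n $ 4 $ 4 * M n $ 5 $ 5 - (M n $ 4 $ 5)\<^sup>2) * \<tau> n"
  then have eqs: "\<tau>4 = (\<lambda>n. M n $ 4 $ 4 * \<tau> n)" "\<tau>5 = (\<lambda>n. M n $ 5 $ 5 * \<tau> n)"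
      "\<tau>45 = (\<lambda>n. (M n $ 4 $ 4 * M n $ 5 $ 5 - (M n $ 4 $ 5)\<^sup>2) * \<tau> n)" by auto
  note dckp = dCKP_principal_minors[OF M sym \<tau>]
  show "dCKP \<tau>" "dCKP \<tau>4" "dCKP \<tau>5" "dCKP \<tau>45"
    unfolding eqs by (fact dckp)+
  \<comment> \<open>The root below is the absolute value of \<open>\<tau> n * M n $ 4 $ 5\<close>,
    and \<open>\<sigma>\<close> restores the sign; where the product vanishes, the value 1 is an
    arbitrary choice.\<close>
  define \<sigma> :: "lattice \<Rightarrow> real" where "\<sigma> n = (if 0 \<le> \<tau> n * M n $ 4 $ 5 then 1 else -1)" for n
  have "linear \<Phi>" using assms(1) unfolding lie_identification_def by blast
  have "circle_has_coords \<Phi> (c n)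
     (\<tau> n, \<tau>45 n, \<tau>4 n, \<tau>5 n, \<sigma> n * sqrt (\<tau>4 n * \<tau>5 n - \<tau> n * \<tau>45 n))" for n
  proof -
    have "\<tau>4 n * \<tau>5 n - \<tau> n * \<tau>45 n = (\<tau> n * M n $ 4 $ 5)\<^sup>2"
      unfolding eqs by algebra
    then have "\<sigma> n * sqrt (\<tau>4 n * \<tau>5 n - \<tau> n * \<tau>45 n) = \<tau> n * M n $ 4 $ 5"
      by (simp add: \<sigma>_def)
    moreover have "circle_has_coords \<Phi> (c n) (\<tau> n *\<^sub>R
        (1, M n $ 4 $ 4 * M n $ 5 $ 5 - (M n $ 4 $ 5)\<^sup>2, M n $ 4 $ 4, M n $ 5 $ 5, M n $ 4 $ 5))"
      by (intro circle_has_coords_scaleR represented_by_coords \<open>linear \<Phi>\<close> assms(3) nz[rule_format])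
    ultimately show ?thesis by (simp add: eqs mult.commute)
  qed
  moreover have "\<forall>n. \<sigma> n = 1 \<or> \<sigma> n = -1" by (simp add: \<sigma>_def)
  ultimately show "\<exists>\<sigma> :: lattice \<Rightarrow> real. (\<forall>n. \<sigma> n = 1 \<or> \<sigma> n = -1) \<and>
          (\<forall>n. circle_has_coords \<Phi> (c n)
             (\<tau> n, \<tau>45 n, \<tau>4 n, \<tau>5 n, \<sigma> n * sqrt (\<tau>4 n * \<tau>5 n - \<tau> n * \<tau>45 n)))"
    by blast
qed

end
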